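(* Assume that $X$ is a strictly convex separable Banach space, that $X_d$ is a uniformly convex CB-space, that $K\in B(X)$ has a pseudo-inverse $K^\dagger$ (under the conditions on $K^{\dagger}$ stated in the context), and that $\{f_j\}\subseteq X$ is an $X_d^*$-$K$-frame for $X^*$ with $X_d^*$-$K$-frame bounds $A$ and $B$. Let $\{g_j\}$ be a sequence in $X$. Suppose there exist $\alpha,\beta,\gamma\ge0$ such that for any finite sequence $\{c_j\}\in X_d$, $$\Big\|\sum_jc_j(g_j-f_j)\Big\|_X\le\alpha\Big\|\sum_jc_jf_j\Big\|_X+\beta\Big\|\sum_jc_jg_j\Big\|_X+\gamma\|\{c_j\}\|_{X_d},$$ with $\max\{\beta,\ \alpha+\gamma A^{-1}\|K^\dagger\|\,\|\Phi\|\}<1$. Then $\{g_j\}$ is an $X_d^*$-$PK$-frame for $X^*$, where $P$ is the orthogonal projection operator from $X$ onto $Q(R(K^* ))$, $Q:=V\Phi U^*$, and $U,V:X_d\to X$ are the synthesis operators of $\{f_j\}$ and $\{g_j\}$, respectively, i.e. $U(\{c_j\})=\sum_jc_jf_j$ and $V(\{c_j\})=\sum_jc_jg_j$.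
   Context: $[\cdot,\cdot]$ is a compatible semi-inner product on $X$ (complex): a map $X\times X\to\mathbb C$, linear in the first variable, with $[f,\lambda g]=\overline\lambda[f,g]$, $[f,f]\ge 0$ with equality only for $f=0$, $|[f,g]|^2\le[f,f][g,g]$, and $[f,f]=\|f\|_X^2$. For $f\in X$, its dual element $f^*\in X^*$ is $f^*(g)=[g,f]$. The duality mapping $f\mapsto f^*$ from $X$ to $X^*$ is taken to be a bijection with $\|f^*\|=\|f\|$; thus every element of $X^*$ is written $f^*$ for a unique $f\in X$. $B(X)$ denotes the bounded linear operators on $X$, $L^*$ is the dual (adjoint) operator of $L$, and $R(\cdot)$, $N(\cdot)$ denote range and null space. A BK-space is a Banach space of scalar sequences with continuous coordinate functionals; a CB-space is a BK-space in which the canonical unit vectors $e_j$ form a Schauder basis. The dual $X_d^*$ of $X_d$ is regarded as a sequence space: $\{d_j\}\in X_d^*$ means that $\{c_j\}\mapsto\sum_jc_jd_j$ is a bounded linear functional on $X_d$, and $\|\{d_j\}\|_{X_d^*}$ is its norm (every $F\in X_d^*$ arises from $d_j=F(e_j)$). A finite sequence is one with finitely many nonzero terms. For $L\in B(X)$, $\{f_j\}\subseteq X$ is an $X_d^*$-$L$-frame for $X^*$ with bounds $A,B>0$ if $\{[f_j,f]\}\in X_d^*$ and $A\|L^*f^*\|_{X^*}\le\|\{[f_j,f]\}\|_{X_d^*}\le B\|f^*\|_{X^*}$ for all $f\in X$. $\Phi=\Phi_{X_d^*}:X_d^*\to X_d^{**}=X_d$ is the duality mapping: $\Phi(c^* )$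 is the unique $c^{**}\in X_d^{**}$ with $c^{**}(c^* )=\|c^*\|^2=\|c^{**}\|^2$ (single-valued, and with values in $X_d$, because $X_d$ is uniformly convex, hence reflexive). $\|\Phi\|=\sup_{\|c^*\|=1}\|\Phi(c^* )\|$. Pseudo-inverse and conditions on $K^\dagger$: $R(K)$ is closed, and $X$ is the topological sum of $N(K)$ and a closed subspace $N(K)^c$, and also of $R(K)$ and a closed subspace $R(K)^c$; $K^\dagger\in B(X)$ is defined by $K^\dagger Kf=f$ for $f\in N(K)^c$ and $K^\dagger g=0$ for $g\in R(K)^c$, so that $KK^\dagger g=g$ for $g\in R(K)$. In using $K^\dagger$ the paper works under the conditions that include $\|f^*\|\le\|K^\dagger\|\,\|K^*f^*\|$ for every $f^*\in R(K^* )$. "Orthogonal projection from $X$ onto $M$" is read as a linear projection $P\in B(X)$, $P^2=P$, with range $M$ and $\|P\|\le1$. *)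

theory Defs
  imports "HOL-Analysis.Analysis"
begin

class complex_normed_vector = real_normed_vector +
  fixes scaleC :: "complex \<Rightarrow> 'a \<Rightarrow> 'a"  (infixr "*\<^sub>C" 75)
  assumes scaleC_add_right: "a *\<^sub>C (x + y) = a *\<^sub>C x + a *\<^sub>C y"
    and scaleC_add_left: "(a + b) *\<^sub>C x = a *\<^sub>C x + b *\<^sub>C x"
    and scaleC_scaleC: "a *\<^sub>C (b *\<^sub>C x) = (a * b) *\<^sub>C x"
    and scaleC_of_real: "complex_of_real r *\<^sub>C x = r *\<^sub>R x"
    and norm_scaleC: "norm (a *\<^sub>C x) = cmod a * norm x"

class complex_banach = complex_normed_vector + complete_space

instantiation complex :: complex_banach
begin
definition scaleC_complex :: "complex \<Rightarrow> complex \<Rightarrow> complex" where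
  "scaleC_complex a x = a * x"
instance
  by standard (auto simp: scaleC_complex_def algebra_simps norm_mult scaleR_conv_of_real)
end

definition csubspace :: "'a::complex_normed_vector set \<Rightarrow> bool" where
  "csubspace M \<longleftrightarrow> 0 \<in> M \<and> (\<forall>x\<in>M. \<forall>y\<in>M. x + y \<in> M) \<and> (\<forall>a. \<forall>x\<in>M. a *\<^sub>C x \<in> M)"

definition bounded_clinear ::
    "('a::complex_normed_vector \<Rightarrow> 'b::complex_normed_vector) \<Rightarrow> bool" where
  "bounded_clinear T \<longleftrightarrow> bounded_linear T \<and> (\<forall>a x. T (a *\<^sub>C x) = a *\<^sub>C T x)"

definition dual_space :: "('a::complex_normed_vector \<Rightarrow> complex) set" where
  "dual_space = {F. bounded_clinear F}"

text \<open>The dual operator \<open>L\<^sup>*\<close>; the norm on \<open>X\<^sup>*\<close> and on \<open>B(X)\<close> is \<^const>\<open>onorm\<close>.\<close>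

definition dual_op :: "('a \<Rightarrow> 'b) \<Rightarrow> ('b \<Rightarrow> complex) \<Rightarrow> 'a \<Rightarrow> complex" where
  "dual_op L F = F \<circ> L"

definition strictly_convex :: "'a::real_normed_vector itself \<Rightarrow> bool" where
  "strictly_convex _ \<longleftrightarrow>
     (\<forall>x y::'a. norm x = 1 \<and> norm y = 1 \<and> x \<noteq> y \<longrightarrow> norm (x + y) < 2)"

definition topological_sum ::
    "'a::complex_normed_vector set \<Rightarrow> 'a set \<Rightarrow> bool" where
  "topological_sum M N \<longleftrightarrow> csubspace M \<and> csubspace N \<and>
     (\<exists>s. homeomorphism (M \<times> N) UNIV (\<lambda>(x, y). x + y) s)"

definition pseudo_inverse ::
    "('a::complex_normed_vector \<Rightarrow> 'a) \<Rightarrow> ('a \<Rightarrow> 'a) \<Rightarrow> bool" where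
  "pseudo_inverse K Kd \<longleftrightarrow> bounded_clinear Kd \<and> closed (range K) \<and>
     (\<exists>Nc Rc. closed Nc \<and> topological_sum (K -` {0}) Nc \<and>
        closed Rc \<and> topological_sum (range K) Rc \<and>
        (\<forall>x\<in>Nc. Kd (K x) = x) \<and> (\<forall>y\<in>Rc. Kd y = 0))"

definition orthogonal_projection_onto ::
    "('a::complex_normed_vector \<Rightarrow> 'a) \<Rightarrow> 'a set \<Rightarrow> bool" where
  "orthogonal_projection_onto P M \<longleftrightarrow>
     bounded_clinear P \<and> P \<circ> P = P \<and> range P = M \<and> onorm P \<le> 1"

definition compatible_sip ::
    "('a::complex_normed_vector \<Rightarrow> 'a \<Rightarrow> complex) \<Rightarrow> bool" where
  "compatible_sip sip \<longleftrightarrow>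
     (\<forall>x y z. sip (x + y) z = sip x z + sip y z) \<and>
     (\<forall>a x z. sip (a *\<^sub>C x) z = a * sip x z) \<and>
     (\<forall>a x z. sip x (a *\<^sub>C z) = cnj a * sip x z) \<and>
     (\<forall>x. sip x x \<in> \<real> \<and> Re (sip x x) \<ge> 0) \<and>
     (\<forall>x. sip x x = 0 \<longrightarrow> x = 0) \<and>
     (\<forall>x y. (cmod (sip x y))\<^sup>2 \<le> Re (sip x x) * Re (sip y y)) \<and>
     (\<forall>x. sip x x = complex_of_real ((norm x)\<^sup>2))"

definition dual_elem :: "('a \<Rightarrow> 'a \<Rightarrow> complex) \<Rightarrow> 'a \<Rightarrow> 'a \<Rightarrow> complex" where
  "dual_elem sip f = (\<lambda>g. sip g f)"

definition sip_duality ::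
    "('a::complex_normed_vector \<Rightarrow> 'a \<Rightarrow> complex) \<Rightarrow> bool" where
  "sip_duality sip \<longleftrightarrow> bij_betw (dual_elem sip) UNIV dual_space \<and>
     (\<forall>f. onorm (dual_elem sip f) = norm f)"

text \<open>A sequence space is given by its carrier \<open>S\<close> and its norm \<open>N\<close>; values of
  \<open>N\<close> outside \<open>S\<close> play no role.\<close>

type_synonym cseq = "nat \<Rightarrow> complex"

definition unit_seq :: "nat \<Rightarrow> cseq" where
  "unit_seq j = (\<lambda>k. if k = j then 1 else 0)"

definition BK_space :: "cseq set \<Rightarrow> (cseq \<Rightarrow> real) \<Rightarrow> bool" where
  "BK_space S N \<longleftrightarrow>
     (\<lambda>_. 0) \<in> S \<and>
     (\<forall>c\<in>S. \<forall>d\<in>S. (\<lambda>j. c j + d j) \<in> S) \<and>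
     (\<forall>a. \<forall>c\<in>S. (\<lambda>j. a * c j) \<in> S) \<and>
     (\<forall>c\<in>S. N c \<ge> 0 \<and> (N c = 0 \<longleftrightarrow> c = (\<lambda>_. 0))) \<and>
     (\<forall>a. \<forall>c\<in>S. N (\<lambda>j. a * c j) = cmod a * N c) \<and>
     (\<forall>c\<in>S. \<forall>d\<in>S. N (\<lambda>j. c j + d j) \<le> N c + N d) \<and>
     (\<forall>x. (\<forall>n. x n \<in> S) \<and>
          (\<forall>e>0. \<exists>n0. \<forall>m\<ge>n0. \<forall>n\<ge>n0. N (\<lambda>j. x m j - x n j) < e) \<longrightarrow>
          (\<exists>c\<in>S. (\<lambda>n. N (\<lambda>j. x n j - c j)) \<longlonglongrightarrow> 0)) \<and>
     (\<forall>j. \<exists>C. \<forall>c\<in>S. cmod (c j) \<le> C * N c)"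

definition CB_space :: "cseq set \<Rightarrow> (cseq \<Rightarrow> real) \<Rightarrow> bool" where
  "CB_space S N \<longleftrightarrow> BK_space S N \<and> (\<forall>j. unit_seq j \<in> S) \<and>
     (\<forall>c\<in>S. \<exists>!a::cseq.
        (\<lambda>n. N (\<lambda>k. c k - (\<Sum>j<n. a j * unit_seq j k))) \<longlonglongrightarrow> 0)"

definition uniformly_convex :: "cseq set \<Rightarrow> (cseq \<Rightarrow> real) \<Rightarrow> bool" where
  "uniformly_convex S N \<longleftrightarrow>
     (\<forall>e>0. \<exists>\<delta>>0. \<forall>c\<in>S. \<forall>d\<in>S.
        N c = 1 \<and> N d = 1 \<and> N (\<lambda>j. c j - d j) \<ge> e \<longrightarrow>
        N (\<lambda>j. (c j + d j) / 2) \<le> 1 - \<delta>)"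

definition pairing :: "cseq \<Rightarrow> cseq \<Rightarrow> complex" where
  "pairing c d = (\<Sum>j. c j * d j)"

definition seq_dual :: "cseq set \<Rightarrow> (cseq \<Rightarrow> real) \<Rightarrow> cseq set" where
  "seq_dual S N = {d. (\<forall>c\<in>S. summable (\<lambda>j. c j * d j)) \<and>
                      (\<exists>C. \<forall>c\<in>S. cmod (pairing c d) \<le> C * N c)}"

definition seq_dual_norm :: "cseq set \<Rightarrow> (cseq \<Rightarrow> real) \<Rightarrow> cseq \<Rightarrow> real" where
  "seq_dual_norm S N d = Sup {cmod (pairing c d) | c. c \<in> S \<and> N c \<le> 1}"

definition seq_of_functional :: "(cseq \<Rightarrow> complex) \<Rightarrow> cseq" where
  "seq_of_functional F = (\<lambda>j. F (unit_seq j))"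

text \<open>The bidual consists of all bounded linear functionals on \<open>X\<^sub>d\<^sup>*\<close>, made
  \<^const>\<open>extensional\<close> so that equality of functionals is equality on \<open>X\<^sub>d\<^sup>*\<close>.\<close>

definition seq_bidual :: "cseq set \<Rightarrow> (cseq \<Rightarrow> real) \<Rightarrow> (cseq \<Rightarrow> complex) set" where
  "seq_bidual S N = {\<phi>. \<phi> \<in> extensional (seq_dual S N) \<and>
     (\<forall>d\<in>seq_dual S N. \<forall>d'\<in>seq_dual S N. \<phi> (\<lambda>j. d j + d' j) = \<phi> d + \<phi> d') \<and>
     (\<forall>a. \<forall>d\<in>seq_dual S N. \<phi> (\<lambda>j. a * d j) = a * \<phi> d) \<and>
     (\<exists>C. \<forall>d\<in>seq_dual S N. cmod (\<phi> d) \<le> C * seq_dual_norm S N d)}"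

definition seq_bidual_norm ::
    "cseq set \<Rightarrow> (cseq \<Rightarrow> real) \<Rightarrow> (cseq \<Rightarrow> complex) \<Rightarrow> real" where
  "seq_bidual_norm S N \<phi> =
     Sup {cmod (\<phi> d) | d. d \<in> seq_dual S N \<and> seq_dual_norm S N d \<le> 1}"

definition bidual_duality_map ::
    "cseq set \<Rightarrow> (cseq \<Rightarrow> real) \<Rightarrow> cseq \<Rightarrow> (cseq \<Rightarrow> complex)" where
  "bidual_duality_map S N d = (THE \<phi>. \<phi> \<in> seq_bidual S N \<and>
     \<phi> d = complex_of_real ((seq_dual_norm S N d)\<^sup>2) \<and>
     (seq_dual_norm S N d)\<^sup>2 = (seq_bidual_norm S N \<phi>)\<^sup>2)"

text \<open>\<open>\<Phi>\<close> is the duality mapping of \<open>X\<^sub>d\<^sup>*\<close> followed by the inverse of the canonical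
  embedding of \<open>X\<^sub>d\<close> into \<open>X\<^sub>d\<^sup>*\<^sup>*\<close>.\<close>

definition duality_map :: "cseq set \<Rightarrow> (cseq \<Rightarrow> real) \<Rightarrow> cseq \<Rightarrow> cseq" where
  "duality_map S N d = (THE c. c \<in> S \<and>
     (\<forall>d'\<in>seq_dual S N. bidual_duality_map S N d d' = pairing c d'))"

definition duality_map_norm :: "cseq set \<Rightarrow> (cseq \<Rightarrow> real) \<Rightarrow> real" where
  "duality_map_norm S N =
     Sup {N (duality_map S N d) | d. d \<in> seq_dual S N \<and> seq_dual_norm S N d = 1}"

definition synthesis :: "(nat \<Rightarrow> 'a::complex_normed_vector) \<Rightarrow> cseq \<Rightarrow> 'a" where
  "synthesis f c = (\<Sum>j. c j *\<^sub>C f j)"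

definition L_frame_bounds ::
    "cseq set \<Rightarrow> (cseq \<Rightarrow> real) \<Rightarrow> ('a::complex_normed_vector \<Rightarrow> 'a \<Rightarrow> complex) \<Rightarrow>
     ('a \<Rightarrow> 'a) \<Rightarrow> (nat \<Rightarrow> 'a) \<Rightarrow> real \<Rightarrow> real \<Rightarrow> bool" where
  "L_frame_bounds S N sip L f A B \<longleftrightarrow> bounded_clinear L \<and> A > 0 \<and> B > 0 \<and>
     (\<forall>x. (\<lambda>j. sip (f j) x) \<in> seq_dual S N \<and>
          A * onorm (dual_op L (dual_elem sip x)) \<le> seq_dual_norm S N (\<lambda>j. sip (f j) x) \<and>
          seq_dual_norm S N (\<lambda>j. sip (f j) x) \<le> B * onorm (dual_elem sip x))"

definition L_frame ::
    "cseq set \<Rightarrow> (cseq \<Rightarrow> real) \<Rightarrow> ('a::complex_normed_vector \<Rightarrow> 'a \<Rightarrow> complex) \<Rightarrow>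
     ('a \<Rightarrow> 'a) \<Rightarrow> (nat \<Rightarrow> 'a) \<Rightarrow> bool" where
  "L_frame S N sip L f \<longleftrightarrow> (\<exists>A B. L_frame_bounds S N sip L f A B)"

text \<open>The map \<open>Q = V \<Phi> U\<^sup>*\<close> from \<open>X\<^sup>*\<close> to \<open>X\<close>, where \<open>U\<close> and \<open>V\<close> are the synthesis operators
  of \<open>f\<close> and \<open>g\<close>, and the functional \<open>U\<^sup>* F\<close> on \<open>X\<^sub>d\<close> is regarded as a sequence.
  It need not be linear, since \<open>\<Phi>\<close> is not.\<close>

definition Q_map ::
    "cseq set \<Rightarrow> (cseq \<Rightarrow> real) \<Rightarrow> (nat \<Rightarrow> 'a::complex_normed_vector) \<Rightarrow> (nat \<Rightarrow> 'a) \<Rightarrow>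
     ('a \<Rightarrow> complex) \<Rightarrow> 'a" where
  "Q_map S N f g F =
     synthesis g (duality_map S N (seq_of_functional (dual_op (synthesis f) F)))"

end

theory Submission
  imports Defs
begin

text \<open>
  Write \<open>U\<close> and \<open>V\<close> for the synthesis operators of \<open>f\<close> and \<open>g\<close>, \<open>\<Phi>\<close> for the duality map and
  \<open>\<kappa> = \<parallel>K\<^sup>\<dagger>\<parallel> / A\<close>. The upper frame bound makes \<open>U\<close> bounded, the perturbation inequality with
  \<open>\<beta> < 1\<close> then makes \<open>V\<close> bounded on finite sequences and, by completeness, everywhere; duality
  turns this into the upper frame bound for \<open>g\<close>.

  For the lower bound, the point is that every \<open>m\<close> in the range of \<open>P\<close> has a preimage under \<open>V\<close>
  whose norm is controlled by that of \<open>m\<close>. Such an \<open>m\<close> is \<open>V c\<close> with \<open>c = \<Phi> (U\<^sup>* F)\<close> and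
  \<open>F \<in> R(K\<^sup>*)\<close>. The two defining properties of \<open>\<Phi>\<close>, namely \<open>\<parallel>c\<parallel> = \<parallel>U\<^sup>* F\<parallel>\<close> and
  \<open>F (U c) = \<parallel>U\<^sup>* F\<parallel>\<^sup>2\<close>, together with \<open>\<parallel>F\<parallel> \<le> \<parallel>K\<^sup>\<dagger>\<parallel> \<parallel>K\<^sup>* F\<parallel> \<le> \<kappa> \<parallel>U\<^sup>* F\<parallel>\<close>, give
  \<open>\<parallel>c\<parallel> \<le> \<kappa> \<parallel>U c\<parallel>\<close>. The perturbation inequality at \<open>c\<close> now reads
  \<open>(1 - \<alpha> - \<gamma> \<kappa>) \<parallel>U c\<parallel> \<le> (1 + \<beta>) \<parallel>V c\<parallel>\<close>, so \<open>\<parallel>c\<parallel> \<le> C' \<parallel>m\<parallel>\<close> for a constant \<open>C'\<close>. Apply this to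
  \<open>m = P (K y)\<close>: for a functional \<open>G\<close> on the space,
  \<open>\<bar>G (P (K y))\<bar> = \<bar>(V\<^sup>* G) c\<bar> \<le> \<parallel>V\<^sup>* G\<parallel> C' \<parallel>K\<parallel> \<parallel>y\<parallel>\<close>, which is the lower frame bound.

  What has to be built is the duality map: that it is single-valued, takes values in the sequence
  space, and has norm \<open>1\<close> (lemmas \<open>duality_map\<close> and \<open>duality_map_norm_eq_1\<close>). Uniform convexity and completeness give a
  maximiser \<open>c\<close> for each functional \<open>d\<close> (\<open>norm_attained\<close>), and a perturbation argument shows that
  evaluation at \<open>c\<close> is the only element of the bidual that norms \<open>d\<close>
  (\<open>norming_functional_unique\<close>).
\<close>

section \<open>Banach sequence spaces and the duality pairing\<close>

locale BK =
  fixes S :: "cseq set" and N :: "cseq \<Rightarrow> real"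
  assumes BK_space: "BK_space S N"
begin

abbreviation D :: "cseq set" where "D \<equiv> seq_dual S N"
abbreviation dn :: "cseq \<Rightarrow> real" where "dn \<equiv> seq_dual_norm S N"

lemma zero_mem: "(\<lambda>_. 0) \<in> S"
  and add_mem: "c \<in> S \<Longrightarrow> d \<in> S \<Longrightarrow> (\<lambda>j. c j + d j) \<in> S"
  and scale_mem: "c \<in> S \<Longrightarrow> (\<lambda>j. a * c j) \<in> S"
  and N_ge0: "c \<in> S \<Longrightarrow> 0 \<le> N c"
  and N_eq0_iff: "c \<in> S \<Longrightarrow> N c = 0 \<longleftrightarrow> c = (\<lambda>_. 0)"
  and N_scale: "c \<in> S \<Longrightarrow> N (\<lambda>j. a * c j) = cmod a * N c"
  and N_triangle: "c \<in> S \<Longrightarrow> d \<in> S \<Longrightarrow> N (\<lambda>j. c j + d j) \<le> N c + N d"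
  using BK_space unfolding BK_space_def by blast+

lemma N_complete:
  assumes "\<And>n. x n \<in> S"
    and "\<And>e. e > 0 \<Longrightarrow> \<exists>n0. \<forall>m\<ge>n0. \<forall>n\<ge>n0. N (\<lambda>j. x m j - x n j) < e"
  shows "\<exists>c\<in>S. (\<lambda>n. N (\<lambda>j. x n j - c j)) \<longlonglongrightarrow> 0"
proof -
  have "\<forall>x. (\<forall>n. x n \<in> S) \<and>
          (\<forall>e>0. \<exists>n0. \<forall>m\<ge>n0. \<forall>n\<ge>n0. N (\<lambda>j. x m j - x n j) < e) \<longrightarrow>
          (\<exists>c\<in>S. (\<lambda>n. N (\<lambda>j. x n j - c j)) \<longlonglongrightarrow> 0)"
    using BK_space unfolding BK_space_def by (elim conjE)
  with assms show ?thesis by blast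
qed

lemma coordinate_bounded: "\<exists>C. \<forall>c\<in>S. cmod (c j) \<le> C * N c"
  using BK_space unfolding BK_space_def by blast

lemma diff_mem: "c \<in> S \<Longrightarrow> d \<in> S \<Longrightarrow> (\<lambda>j. c j - d j) \<in> S"
  using add_mem[of c "\<lambda>j. (-1) * d j"] scale_mem[of d "-1"] by simp

lemma N_zero: "N (\<lambda>_. 0) = 0"
  using N_eq0_iff zero_mem by blast

lemma N_diff_commute:
  assumes "c \<in> S" "d \<in> S"
  shows "N (\<lambda>j. c j - d j) = N (\<lambda>j. d j - c j)"
  using N_scale[OF diff_mem[OF assms], of "-1"] by simp

lemma N_diff_triangle:
  assumes "a \<in> S" "b \<in> S" "c \<in> S"
  shows "N (\<lambda>j. a j - c j) \<le> N (\<lambda>j. a j - b j) + N (\<lambda>j. b j - c j)"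
  using N_triangle[OF diff_mem[OF assms(1,2)] diff_mem[OF assms(2,3)]] by simp

lemma N_reverse_triangle:
  assumes "c \<in> S" "d \<in> S"
  shows "\<bar>N c - N d\<bar> \<le> N (\<lambda>j. c j - d j)"
  using N_triangle[OF diff_mem[OF assms] assms(2)]
    N_triangle[OF diff_mem[OF assms(2,1)] assms(1)] N_diff_commute[OF assms] by simp

lemma N_tendsto:
  assumes "\<And>n. x n \<in> S" "c \<in> S" "(\<lambda>n. N (\<lambda>j. x n j - c j)) \<longlonglongrightarrow> 0"
  shows "(\<lambda>n. N (x n)) \<longlonglongrightarrow> N c"
proof -
  have "(\<lambda>n. N (x n) - N c) \<longlonglongrightarrow> 0"
    by (rule tendsto_rabs_zero_cancel, rule tendsto_sandwich[OF _ _ tendsto_const assms(3)])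
      (use N_reverse_triangle[OF assms(1,2)] in auto)
  then show ?thesis by (simp add: LIM_zero_iff)
qed

lemma dual_summable: "d \<in> D \<Longrightarrow> c \<in> S \<Longrightarrow> summable (\<lambda>j. c j * d j)"
  unfolding seq_dual_def by blast

lemma pairing_add_left:
  "d \<in> D \<Longrightarrow> c \<in> S \<Longrightarrow> c' \<in> S \<Longrightarrow> pairing (\<lambda>j. c j + c' j) d = pairing c d + pairing c' d"
  unfolding pairing_def by (simp add: distrib_right suminf_add dual_summable)

lemma pairing_diff_left:
  "d \<in> D \<Longrightarrow> c \<in> S \<Longrightarrow> c' \<in> S \<Longrightarrow> pairing (\<lambda>j. c j - c' j) d = pairing c d - pairing c' d"
  unfolding pairing_def by (simp add: left_diff_distrib suminf_diff dual_summable)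

lemma pairing_scale_left:
  "d \<in> D \<Longrightarrow> c \<in> S \<Longrightarrow> pairing (\<lambda>j. a * c j) d = a * pairing c d"
  unfolding pairing_def by (simp add: mult.assoc suminf_mult dual_summable)

lemma pairing_add_right:
  "d \<in> D \<Longrightarrow> d' \<in> D \<Longrightarrow> c \<in> S \<Longrightarrow> pairing c (\<lambda>j. d j + d' j) = pairing c d + pairing c d'"
  unfolding pairing_def by (simp add: distrib_left suminf_add dual_summable)

lemma pairing_scale_right:
  "d \<in> D \<Longrightarrow> c \<in> S \<Longrightarrow> pairing c (\<lambda>j. a * d j) = a * pairing c d"
  unfolding pairing_def by (simp add: mult.left_commute suminf_mult dual_summable)

lemma pairing_zero_left: "pairing (\<lambda>_. 0) d = 0"
  by (simp add: pairing_def)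

lemma dual_norm_bdd:
  assumes "d \<in> D"
  shows "bdd_above {cmod (pairing c d) |c. c \<in> S \<and> N c \<le> 1}"
proof -
  obtain C where C: "\<And>c. c \<in> S \<Longrightarrow> cmod (pairing c d) \<le> C * N c"
    using assms unfolding seq_dual_def by blast
  have "cmod (pairing c d) \<le> \<bar>C\<bar>" if "c \<in> S" "N c \<le> 1" for c
  proof -
    have "C * N c \<le> \<bar>C\<bar> * 1"
      using that N_ge0 by (intro mult_mono) auto
    then show ?thesis using C that by fastforce
  qed
  then show ?thesis by (auto intro!: bdd_aboveI)
qed

lemma dual_norm_upper: "d \<in> D \<Longrightarrow> c \<in> S \<Longrightarrow> N c \<le> 1 \<Longrightarrow> cmod (pairing c d) \<le> dn d"
  unfolding seq_dual_norm_def by (rule cSup_upper) (auto intro: dual_norm_bdd)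

lemma dual_norm_ge0: "d \<in> D \<Longrightarrow> 0 \<le> dn d"
  using dual_norm_upper[OF _ zero_mem] by (simp add: N_zero pairing_zero_left)

lemma norm_pairing_le:
  assumes "d \<in> D" "c \<in> S"
  shows "cmod (pairing c d) \<le> dn d * N c"
proof (cases "N c = 0")
  case True
  then show ?thesis using N_eq0_iff[OF assms(2)] by (simp add: pairing_zero_left)
next
  case False
  then have pos: "N c > 0" using N_ge0 assms by force
  have "cmod (pairing (\<lambda>j. inverse (complex_of_real (N c)) * c j) d) \<le> dn d"
    using pos by (intro dual_norm_upper assms scale_mem)
      (simp add: N_scale assms norm_inverse)
  then have "inverse (N c) * cmod (pairing c d) \<le> dn d"
    using pos by (simp only: pairing_scale_left[OF assms] norm_mult norm_inverse norm_of_real abs_of_pos)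
  then show ?thesis using pos by (simp add: field_simps)
qed

lemma dual_norm_le:
  assumes "\<And>c. c \<in> S \<Longrightarrow> cmod (pairing c d) \<le> C * N c" "0 \<le> C"
  shows "dn d \<le> C"
  unfolding seq_dual_norm_def
proof (rule cSup_least)
  show "{cmod (pairing c d) |c. c \<in> S \<and> N c \<le> 1} \<noteq> {}"
    using zero_mem N_zero by force
next
  fix x assume "x \<in> {cmod (pairing c d) |c. c \<in> S \<and> N c \<le> 1}"
  then obtain c where c: "x = cmod (pairing c d)" "c \<in> S" "N c \<le> 1" by blast
  have "x \<le> C * N c" using assms(1) c by simp
  also have "\<dots> \<le> C * 1" using assms(2) c by (intro mult_left_mono) auto
  finally show "x \<le> C" by simp
qed

lemma dual_add_mem:
  assumes "d \<in> D" "d' \<in> D"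
  shows "(\<lambda>j. d j + d' j) \<in> D"
proof -
  have "cmod (pairing c (\<lambda>j. d j + d' j)) \<le> (dn d + dn d') * N c" if "c \<in> S" for c
    using norm_pairing_le[OF assms(1) that] norm_pairing_le[OF assms(2) that]
      norm_triangle_ineq[of "pairing c d" "pairing c d'"]
    by (simp add: pairing_add_right assms that algebra_simps)
  moreover have "summable (\<lambda>j. c j * (d j + d' j))" if "c \<in> S" for c
    using summable_add[OF dual_summable[OF assms(1) that] dual_summable[OF assms(2) that]]
    by (simp add: algebra_simps)
  ultimately show ?thesis unfolding seq_dual_def by blast
qed

lemma dual_scale_mem:
  assumes "d \<in> D"
  shows "(\<lambda>j. a * d j) \<in> D"
proof -
  have "cmod (pairing c (\<lambda>j. a * d j)) \<le> (cmod a * dn d) * N c" if "c \<in> S" for c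
    using mult_left_mono[OF norm_pairing_le[OF assms(1) that], of "cmod a"]
    by (simp add: pairing_scale_right assms that norm_mult mult.assoc)
  moreover have "summable (\<lambda>j. c j * (a * d j))" if "c \<in> S" for c
    using summable_mult[OF dual_summable[OF assms(1) that], of a]
    by (simp add: mult.left_commute)
  ultimately show ?thesis unfolding seq_dual_def by blast
qed

lemma dual_norm_scale_le:
  assumes "d \<in> D"
  shows "dn (\<lambda>j. a * d j) \<le> cmod a * dn d"
  using mult_left_mono[OF norm_pairing_le[OF assms], of _ "cmod a"]
  by (intro dual_norm_le)
    (simp_all add: pairing_scale_right assms norm_mult mult.assoc dual_norm_ge0)

lemma pairing_unit_seq: "pairing c (unit_seq j) = c j"
proof -
  have "(\<lambda>k. c k * unit_seq j k) = (\<lambda>k. if k = j then c k else 0)"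
    by (auto simp: unit_seq_def)
  then show ?thesis
    using sums_single[of j c] by (simp add: pairing_def sums_iff)
qed

lemma unit_seq_dual: "unit_seq j \<in> D"
proof -
  have "(\<lambda>k. c k * unit_seq j k) = (\<lambda>k. if k = j then c k else 0)" for c
    by (auto simp: unit_seq_def)
  then have "summable (\<lambda>k. c k * unit_seq j k)" for c
    using sums_single[of j c] by (simp add: sums_iff)
  then show ?thesis
    using coordinate_bounded[of j] unfolding seq_dual_def by (simp add: pairing_unit_seq)
qed

text \<open>The coordinate functionals separate the points of the space, and they belong to
  the dual, so the canonical map into the bidual is injective.\<close>

lemma pairing_separates:
  assumes "\<And>d. d \<in> D \<Longrightarrow> pairing c d = pairing c' d"
  shows "c = c'"
  using assms[OF unit_seq_dual] by (auto simp: pairing_unit_seq)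

lemma pairing_tendsto:
  assumes "\<And>n. x n \<in> S" "c \<in> S" "(\<lambda>n. N (\<lambda>j. x n j - c j)) \<longlonglongrightarrow> 0" "d \<in> D"
  shows "(\<lambda>n. pairing (x n) d) \<longlonglongrightarrow> pairing c d"
proof -
  have "(\<lambda>n. pairing (x n) d - pairing c d) \<longlonglongrightarrow> 0"
  proof (rule Lim_null_comparison)
    show "\<forall>\<^sub>F n in sequentially.
        norm (pairing (x n) d - pairing c d) \<le> dn d * N (\<lambda>j. x n j - c j)"
      using norm_pairing_le[OF assms(4) diff_mem[OF assms(1,2)]]
      by (simp add: pairing_diff_left assms)
    show "(\<lambda>n. dn d * N (\<lambda>j. x n j - c j)) \<longlonglongrightarrow> 0"
      using tendsto_mult_right_zero[OF assms(3)] by simp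
  qed
  then show ?thesis by (simp add: LIM_zero_iff)
qed

text \<open>Rotating and normalising a vector at which the modulus of the functional is large makes the
  value real and the norm exactly one; uniform convexity speaks only of unit vectors.\<close>

lemma near_maximiser:
  assumes "d \<in> D" "0 < dn d" "s < dn d"
  shows "\<exists>c\<in>S. N c = 1 \<and> s < Re (pairing c d)"
proof -
  have "max s 0 < Sup {cmod (pairing c d) |c. c \<in> S \<and> N c \<le> 1}"
    using assms by (simp add: seq_dual_norm_def)
  moreover have "{cmod (pairing c d) |c. c \<in> S \<and> N c \<le> 1} \<noteq> {}"
    using zero_mem N_zero by force
  ultimately obtain c where c: "c \<in> S" "N c \<le> 1" "max s 0 < cmod (pairing c d)"
    by (elim less_cSupE) auto
  define z where "z = pairing c d"
  have "N c \<noteq> 0" using c N_eq0_iff[OF c(1)] by (auto simp: pairing_zero_left)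
  then have Npos: "N c > 0" using N_ge0[OF c(1)] by simp
  have zpos: "cmod z > 0" and zs: "s < cmod z" using c by (auto simp: z_def)
  define a where "a = cnj z / complex_of_real (cmod z * N c)"
  have "cmod a = inverse (N c)"
    using Npos zpos by (simp add: a_def norm_divide norm_mult field_simps)
  then have "N (\<lambda>j. a * c j) = 1"
    using Npos N_scale[OF c(1), of a] by simp
  moreover have "pairing (\<lambda>j. a * c j) d = complex_of_real (cmod z / N c)"
  proof -
    have "cnj z * z = complex_of_real (cmod z) * complex_of_real (cmod z)"
      using complex_norm_square[of z] by (simp add: power2_eq_square mult.commute)
    then show ?thesis
      unfolding pairing_scale_left[OF assms(1) c(1)] z_def[symmetric] a_def
      using Npos zpos by (simp add: field_simps)
  qed
  moreover have "cmod z \<le> cmod z / N c"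
    using Npos zpos c(2) by (simp add: field_simps mult_left_le)
  ultimately show ?thesis using scale_mem[OF c(1), of a] zs
    by (intro bexI[of _ "\<lambda>j. a * c j"]) auto
qed

end

section \<open>The duality mapping of the dual of a uniformly convex space\<close>

locale uniformly_convex_BK = BK +
  assumes uniformly_convex: "uniformly_convex S N"
begin

text \<open>The midpoint of two unit vectors at which a functional is almost maximal is again a vector
  at which it is almost maximal, so its norm is close to one; uniform convexity then forces the
  two vectors to be close to each other.\<close>

lemma almost_maximisers_close:
  assumes d: "d \<in> D" "0 < dn d" and "0 < e"
  shows "\<exists>\<delta>>0. \<forall>c\<in>S. \<forall>c'\<in>S. N c = 1 \<and> N c' = 1 \<and>
    dn d - \<delta> < Re (pairing c d) \<and> dn d - \<delta> < Re (pairing c' d) \<longrightarrow> N (\<lambda>j. c j - c' j) < e"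
proof -
  obtain \<delta> where \<delta>: "\<delta> > 0" "\<And>c c'. c \<in> S \<Longrightarrow> c' \<in> S \<Longrightarrow> N c = 1 \<Longrightarrow> N c' = 1 \<Longrightarrow>
      N (\<lambda>j. c j - c' j) \<ge> e \<Longrightarrow> N (\<lambda>j. (c j + c' j) / 2) \<le> 1 - \<delta>"
    using uniformly_convex \<open>0 < e\<close> unfolding uniformly_convex_def by meson
  have "N (\<lambda>j. c j - c' j) < e"
    if c: "c \<in> S" "c' \<in> S" "N c = 1" "N c' = 1"
      and close: "dn d - dn d * \<delta> < Re (pairing c d)" "dn d - dn d * \<delta> < Re (pairing c' d)"
    for c c'
  proof (rule ccontr)
    assume "\<not> N (\<lambda>j. c j - c' j) < e"
    with \<delta>(2)[OF c] have small: "N (\<lambda>j. (c j + c' j) / 2) \<le> 1 - \<delta>" by simp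
    have mem: "(\<lambda>j. (c j + c' j) / 2) \<in> S"
      using scale_mem[OF add_mem[OF c(1,2)], of "1/2"] by simp
    have "pairing (\<lambda>j. (c j + c' j) / 2) d = (pairing c d + pairing c' d) / 2"
      using pairing_scale_left[OF d(1) add_mem[OF c(1,2)], of "1/2"]
      by (simp add: pairing_add_left d c)
    then have "Re (pairing (\<lambda>j. (c j + c' j) / 2) d) = (Re (pairing c d) + Re (pairing c' d)) / 2"
      by (simp only: Re_divide_numeral plus_complex.simps)
    then have "dn d - dn d * \<delta> < Re (pairing (\<lambda>j. (c j + c' j) / 2) d)"
      using close by simp
    also have "\<dots> \<le> dn d * N (\<lambda>j. (c j + c' j) / 2)"
      using norm_pairing_le[OF d(1) mem] complex_Re_le_cmod order_trans by blast
    also have "\<dots> \<le> dn d * (1 - \<delta>)"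
      using small d(2) by (intro mult_left_mono) auto
    finally show False by (simp add: algebra_simps)
  qed
  then show ?thesis using \<delta>(1) d(2) by (intro exI[of _ "dn d * \<delta>"]) auto
qed

text \<open>A maximising sequence is Cauchy because almost maximisers are close to each other.\<close>

lemma norm_attained:
  assumes d: "d \<in> D" "0 < dn d"
  shows "\<exists>c\<in>S. N c = 1 \<and> pairing c d = complex_of_real (dn d)"
proof -
  have "\<exists>c\<in>S. N c = 1 \<and> dn d - 1 / real (Suc n) < Re (pairing c d)" for n
    by (rule near_maximiser[OF d]) simp
  then obtain x where x: "\<And>n. x n \<in> S" "\<And>n. N (x n) = 1"
      "\<And>n. dn d - 1 / real (Suc n) < Re (pairing (x n) d)"
    by metis
  have "\<exists>n0. \<forall>m\<ge>n0. \<forall>n\<ge>n0. N (\<lambda>j. x m j - x n j) < e" if e: "e > 0" for e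
  proof -
    obtain \<delta> where \<delta>: "\<delta> > 0" "\<And>c c'. c \<in> S \<Longrightarrow> c' \<in> S \<Longrightarrow> N c = 1 \<Longrightarrow> N c' = 1 \<Longrightarrow>
        dn d - \<delta> < Re (pairing c d) \<Longrightarrow> dn d - \<delta> < Re (pairing c' d) \<Longrightarrow>
        N (\<lambda>j. c j - c' j) < e"
      using almost_maximisers_close[OF d e] by metis
    obtain n0 where n0: "1 / real (Suc n0) < \<delta>"
      using nat_approx_posE[OF \<delta>(1)] by blast
    have "dn d - \<delta> < Re (pairing (x n) d)" if "n \<ge> n0" for n
    proof -
      have "1 / real (Suc n) \<le> 1 / real (Suc n0)"
        using that by (simp add: field_simps)
      then show ?thesis using n0 x(3)[of n] by linarith
    qed
    then show ?thesis using \<delta>(2) x(1,2) by blast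
  qed
  with N_complete[of x] x(1) obtain c where
    c: "c \<in> S" "(\<lambda>n. N (\<lambda>j. x n j - c j)) \<longlonglongrightarrow> 0" by blast
  have Nc: "N c = 1"
    using N_tendsto[OF x(1) c] by (simp add: x(2) LIMSEQ_const_iff)
  have ge: "dn d \<le> Re (pairing c d)"
  proof (rule LIMSEQ_le)
    show "(\<lambda>n. Re (pairing (x n) d)) \<longlonglongrightarrow> Re (pairing c d)"
      by (intro tendsto_intros pairing_tendsto x c d)
    have "(\<lambda>n. dn d - 1 / real (Suc n)) \<longlonglongrightarrow> dn d - 0"
      by (intro tendsto_diff tendsto_const LIMSEQ_Suc[OF lim_1_over_n])
    then show "(\<lambda>n. dn d - 1 / real (Suc n)) \<longlonglongrightarrow> dn d" by simp
    show "\<exists>n0. \<forall>n\<ge>n0. dn d - 1 / real (Suc n) \<le> Re (pairing (x n) d)"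
      using x(3) less_imp_le by blast
  qed
  have le: "cmod (pairing c d) \<le> dn d" using norm_pairing_le[OF d(1) c(1)] Nc by simp
  have Re: "Re (pairing c d) = dn d"
    using ge le complex_Re_le_cmod[of "pairing c d"] by linarith
  then have "(dn d)\<^sup>2 + (Im (pairing c d))\<^sup>2 \<le> (dn d)\<^sup>2"
    using le power_mono[OF le norm_ge_zero, of 2] by (simp add: cmod_power2)
  then have "Im (pairing c d) = 0" by simp
  then show ?thesis using c(1) Nc Re by (auto intro!: bexI[of _ c] complex_eqI)
qed

text \<open>This is the smoothness of the dual, and it is what makes the duality mapping single-valued.
  Here \<open>\<phi>\<close> is a functional of norm at most one on the dual that agrees with evaluation at \<open>c\<close> on \<open>d\<close>.
  Suppose that \<open>\<phi>\<close> and the maximiser \<open>c\<close> disagree. Then they disagree on some \<open>e\<close> that \<open>c\<close>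
  annihilates and at which \<open>\<phi>\<close> is positive. For small \<open>t > 0\<close> a maximiser of \<open>d + t e\<close>
  is an almost maximiser of \<open>d\<close>, hence close to \<open>c\<close>, hence almost annihilates \<open>e\<close>.
  But the norm of \<open>d + t e\<close> is at least \<open>\<phi> (d + t e) = dn d + t \<phi> e\<close>, so that maximiser pairs
  with \<open>e\<close> to at least \<open>\<phi> e\<close>.\<close>

lemma norming_functional_unique:
  assumes d: "d \<in> D" "0 < dn d"
    and c: "c \<in> S" "N c = 1" "pairing c d = complex_of_real (dn d)"
    and add: "\<And>d d'. d \<in> D \<Longrightarrow> d' \<in> D \<Longrightarrow> \<phi> (\<lambda>j. d j + d' j) = \<phi> d + \<phi> d'"
    and scale: "\<And>a d. d \<in> D \<Longrightarrow> \<phi> (\<lambda>j. a * d j) = a * \<phi> d"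
    and le: "\<And>d. d \<in> D \<Longrightarrow> cmod (\<phi> d) \<le> dn d"
    and \<phi>d: "\<phi> d = complex_of_real (dn d)"
    and d': "d' \<in> D"
  shows "\<phi> d' = pairing c d'"
proof (rule ccontr)
  assume neq: "\<phi> d' \<noteq> pairing c d'"
  \<comment> \<open>\<open>e0\<close> is the component of \<open>d'\<close> that \<open>c\<close> annihilates; \<open>e\<close> is \<open>e0\<close> rotated so that \<open>\<phi> e > 0\<close>.\<close>
  define e0 where "e0 = (\<lambda>j. d' j + (- (pairing c d' / complex_of_real (dn d))) * d j)"
  have e0: "e0 \<in> D" unfolding e0_def by (intro dual_add_mem dual_scale_mem d d')
  have ce0: "pairing c e0 = 0"
    unfolding e0_def pairing_add_right[OF d' dual_scale_mem[OF d(1)] c(1)]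
      pairing_scale_right[OF d(1) c(1)] using d(2) c(3) by simp
  have "\<phi> e0 = \<phi> d' - pairing c d'"
    unfolding e0_def add[OF d' dual_scale_mem[OF d(1)]] scale[OF d(1)]
    using d(2) \<phi>d by simp
  then have "\<phi> e0 \<noteq> 0" using neq by simp
  define e where "e = (\<lambda>j. (cnj (\<phi> e0) / complex_of_real (cmod (\<phi> e0))) * e0 j)"
  define \<eta> where "\<eta> = cmod (\<phi> e0)"
  have \<eta>: "\<eta> > 0" using \<open>\<phi> e0 \<noteq> 0\<close> by (simp add: \<eta>_def)
  have e: "e \<in> D" unfolding e_def by (intro dual_scale_mem e0)
  have ce: "pairing c e = 0"
    unfolding e_def pairing_scale_right[OF e0 c(1)] ce0 by simp
  have "cnj (\<phi> e0) * \<phi> e0 = complex_of_real \<eta> * complex_of_real \<eta>"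
    using complex_norm_square[of "\<phi> e0"] by (simp add: \<eta>_def power2_eq_square mult.commute)
  then have \<phi>e: "\<phi> e = complex_of_real \<eta>"
    unfolding e_def scale[OF e0] using \<eta> by (simp add: \<eta>_def[symmetric])
  have ne: "dn e \<ge> 0" by (rule dual_norm_ge0[OF e])
  \<comment> \<open>A vector within \<open>\<epsilon>\<close> of \<open>c\<close> pairs with \<open>e\<close> to less than \<open>\<eta>\<close>; the step \<open>t\<close> below is short
    enough for a maximiser of \<open>d + t e\<close> to be such a vector.\<close>
  define \<epsilon> where "\<epsilon> = \<eta> / (dn e + 1)"
  have "\<epsilon> > 0" using \<eta> ne by (simp add: \<epsilon>_def)
  obtain \<delta> where \<delta>: "\<delta> > 0" "\<And>c c'. c \<in> S \<Longrightarrow> c' \<in> S \<Longrightarrow> N c = 1 \<Longrightarrow> N c' = 1 \<Longrightarrow>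
      dn d - \<delta> < Re (pairing c d) \<Longrightarrow> dn d - \<delta> < Re (pairing c' d) \<Longrightarrow>
      N (\<lambda>j. c j - c' j) < \<epsilon>"
    using almost_maximisers_close[OF d \<open>\<epsilon> > 0\<close>] by metis
  define t where "t = \<delta> / (dn e + 1)"
  have t: "t > 0" "t * dn e < \<delta>"
    using \<delta>(1) ne by (auto simp: t_def divide_simps)
  define h where "h = (\<lambda>j. d j + complex_of_real t * e j)"
  have h: "h \<in> D" unfolding h_def by (intro dual_add_mem dual_scale_mem d e)
  have "\<phi> h = complex_of_real (dn d + t * \<eta>)"
    unfolding h_def add[OF d(1) dual_scale_mem[OF e]] scale[OF e] \<phi>d \<phi>e by simp
  then have "\<bar>dn d + t * \<eta>\<bar> \<le> dn h"
    using le[OF h] by (simp only: norm_of_real)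
  then have hge: "dn d + t * \<eta> \<le> dn h" by linarith
  then have "0 < dn h" using d(2) t(1) \<eta> by (smt (verit) mult_pos_pos)
  from norm_attained[OF h this] obtain b where
    b: "b \<in> S" "N b = 1" "pairing b h = complex_of_real (dn h)" by blast
  have "pairing b h = pairing b d + complex_of_real t * pairing b e"
    unfolding h_def by (simp add: pairing_add_right dual_scale_mem pairing_scale_right d e b)
  then have sum: "dn h = Re (pairing b d) + t * Re (pairing b e)"
    using arg_cong[OF b(3), of Re] by simp
  have bd: "Re (pairing b d) \<le> dn d"
    using norm_pairing_le[OF d(1) b(1)] b(2) complex_Re_le_cmod[of "pairing b d"] by simp
  have be: "Re (pairing b e) \<le> dn e"
    using norm_pairing_le[OF e b(1)] b(2) complex_Re_le_cmod[of "pairing b e"] by simp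
  have "t * \<eta> \<le> t * Re (pairing b e)" using hge sum bd by linarith
  then have \<eta>_le: "\<eta> \<le> Re (pairing b e)" using t(1) by simp
  have "t * Re (pairing b e) \<le> t * dn e" using be t(1) by simp
  moreover have "0 < t * \<eta>" using t(1) \<eta> by simp
  ultimately have "dn d - \<delta> < Re (pairing b d)"
    using hge sum t(2) by linarith
  then have close: "N (\<lambda>j. b j - c j) < \<epsilon>"
    using \<delta> b c by simp
  have "\<eta> \<le> cmod (pairing (\<lambda>j. b j - c j) e)"
    using \<eta>_le complex_Re_le_cmod[of "pairing b e"] by (simp add: pairing_diff_left e b c ce)
  also have "\<dots> \<le> dn e * N (\<lambda>j. b j - c j)"
    by (intro norm_pairing_le e diff_mem b c)
  also have "\<dots> \<le> dn e * \<epsilon>"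
    using close ne by (intro mult_left_mono) auto
  also have "\<dots> < \<eta>" using \<eta> ne by (simp add: \<epsilon>_def divide_simps)
  finally show False by simp
qed

lemma bidual_norm_upper:
  assumes \<phi>: "\<phi> \<in> seq_bidual S N" and d: "d \<in> D" "dn d \<le> 1"
  shows "cmod (\<phi> d) \<le> seq_bidual_norm S N \<phi>"
proof -
  obtain C where C: "\<And>d. d \<in> D \<Longrightarrow> cmod (\<phi> d) \<le> C * dn d"
    using \<phi> unfolding seq_bidual_def by blast
  have "cmod (\<phi> d) \<le> \<bar>C\<bar>" if "d \<in> D" "dn d \<le> 1" for d
  proof -
    have "C * dn d \<le> \<bar>C\<bar> * 1"
      using that dual_norm_ge0 by (intro mult_mono) auto
    then show ?thesis using C that by fastforce
  qed
  then have "bdd_above {cmod (\<phi> d) |d. d \<in> D \<and> dn d \<le> 1}" by (auto intro!: bdd_aboveI)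
  then show ?thesis unfolding seq_bidual_norm_def using d by (intro cSup_upper) auto
qed

lemma dual_zero_mem: "(\<lambda>_. 0) \<in> D"
  using dual_scale_mem[OF unit_seq_dual, of 0 0] by simp

lemma dual_norm_zero_le: "dn (\<lambda>_. 0) \<le> 1"
  using dual_norm_scale_le[OF unit_seq_dual, of 0 0] by simp

lemma bidual_norm_ge0: "\<phi> \<in> seq_bidual S N \<Longrightarrow> 0 \<le> seq_bidual_norm S N \<phi>"
  by (rule order_trans[OF norm_ge_zero bidual_norm_upper[OF _ dual_zero_mem dual_norm_zero_le]])

lemma norm_bidual_le:
  assumes \<phi>: "\<phi> \<in> seq_bidual S N" and d: "d \<in> D"
  shows "cmod (\<phi> d) \<le> seq_bidual_norm S N \<phi> * dn d"
proof (cases "dn d = 0")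
  case True
  moreover have "\<exists>C. cmod (\<phi> d) \<le> C * dn d"
    using \<phi> d unfolding seq_bidual_def by blast
  ultimately show ?thesis by auto
next
  case False
  then have pos: "dn d > 0" using dual_norm_ge0[OF d] by simp
  let ?a = "inverse (complex_of_real (dn d))"
  have "dn (\<lambda>j. ?a * d j) \<le> 1"
    using dual_norm_scale_le[OF d, of ?a] pos by (simp add: norm_inverse)
  then have "cmod (\<phi> (\<lambda>j. ?a * d j)) \<le> seq_bidual_norm S N \<phi>"
    by (intro bidual_norm_upper[OF \<phi>] dual_scale_mem[OF d])
  moreover have "\<phi> (\<lambda>j. ?a * d j) = ?a * \<phi> d"
    using \<phi> d unfolding seq_bidual_def by blast
  ultimately have "inverse (dn d) * cmod (\<phi> d) \<le> seq_bidual_norm S N \<phi>"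
    using pos by (simp only: norm_mult norm_inverse norm_of_real abs_of_pos)
  then show ?thesis using pos by (simp add: field_simps)
qed

lemma evaluation_in_bidual:
  assumes "c \<in> S"
  shows "restrict (pairing c) D \<in> seq_bidual S N"
proof -
  have "cmod (pairing c d) \<le> N c * dn d" if "d \<in> D" for d
    using norm_pairing_le[OF that assms] by (simp add: mult.commute)
  then show ?thesis
    unfolding seq_bidual_def
    by (auto simp: pairing_add_right pairing_scale_right assms dual_add_mem dual_scale_mem)
qed

lemma evaluation_norm_le:
  assumes "c \<in> S"
  shows "seq_bidual_norm S N (restrict (pairing c) D) \<le> N c"
  unfolding seq_bidual_norm_def
proof (rule cSup_least)
  show "{cmod (restrict (pairing c) D d) |d. d \<in> D \<and> dn d \<le> 1} \<noteq> {}"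
    using dual_zero_mem dual_norm_zero_le by blast
next
  fix x assume "x \<in> {cmod (restrict (pairing c) D d) |d. d \<in> D \<and> dn d \<le> 1}"
  then obtain d where d: "x = cmod (pairing c d)" "d \<in> D" "dn d \<le> 1" by auto
  have "x \<le> dn d * N c" using d norm_pairing_le assms by simp
  also have "\<dots> \<le> 1 * N c" using d N_ge0[OF assms] by (intro mult_right_mono)
  finally show "x \<le> N c" by simp
qed

text \<open>Both descriptions in the definition of the duality mapping are justified at once: the
  multiple of a maximiser of \<open>d\<close> by \<open>dn d\<close> has the required properties, and by smoothness every
  bidual functional with these properties is evaluation at that vector.\<close>

lemma duality_map:
  assumes d: "d \<in> D"
  shows "duality_map S N d \<in> S" (is ?mem)
    and "N (duality_map S N d) = dn d" (is ?norm)
    and "pairing (duality_map S N d) d = complex_of_real ((dn d)\<^sup>2)" (is ?pair)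
proof -
  have "\<exists>c\<in>S. N c = dn d \<and> pairing c d = complex_of_real ((dn d)\<^sup>2) \<and>
      (\<forall>\<phi>\<in>seq_bidual S N. \<phi> d = complex_of_real ((dn d)\<^sup>2) \<longrightarrow> seq_bidual_norm S N \<phi> = dn d \<longrightarrow>
        (\<forall>d'\<in>D. \<phi> d' = pairing c d'))"
  proof (cases "dn d = 0")
    case True
    have "\<phi> d' = 0" if "\<phi> \<in> seq_bidual S N" "seq_bidual_norm S N \<phi> = 0" "d' \<in> D" for \<phi> d'
      using norm_bidual_le[OF that(1,3)] that(2) by simp
    moreover have "cmod (pairing c d) = 0" if "c \<in> S" for c
      using norm_pairing_le[OF d that] True by simp
    ultimately show ?thesis
      using True by (intro bexI[OF _ zero_mem]) (simp add: N_zero pairing_zero_left)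
  next
    case False
    then have pos: "dn d > 0" using dual_norm_ge0[OF d] by simp
    let ?r = "complex_of_real (dn d)"
    from norm_attained[OF d pos] obtain c where
      c: "c \<in> S" "N c = 1" "pairing c d = ?r" by blast
    have "\<phi> d' = pairing (\<lambda>j. ?r * c j) d'"
      if \<phi>: "\<phi> \<in> seq_bidual S N" "\<phi> d = complex_of_real ((dn d)\<^sup>2)" "seq_bidual_norm S N \<phi> = dn d"
        and d': "d' \<in> D" for \<phi> d'
    proof -
      have "\<phi> d' / ?r = pairing c d'"
      proof (rule norming_functional_unique[OF d pos c, of "\<lambda>d. \<phi> d / ?r"])
        show "\<phi> (\<lambda>j. d j + d' j) / ?r = \<phi> d / ?r + \<phi> d' / ?r" if "d \<in> D" "d' \<in> D" for d d'
        proof -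
          have "\<phi> (\<lambda>j. d j + d' j) = \<phi> d + \<phi> d'"
            using \<phi>(1) that unfolding seq_bidual_def by blast
          then show ?thesis by (simp add: add_divide_distrib)
        qed
        show "\<phi> (\<lambda>j. a * d j) / ?r = a * (\<phi> d / ?r)" if "d \<in> D" for a d
        proof -
          have "\<phi> (\<lambda>j. a * d j) = a * \<phi> d"
            using \<phi>(1) that unfolding seq_bidual_def by blast
          then show ?thesis by simp
        qed
        show "cmod (\<phi> d / ?r) \<le> dn d" if "d \<in> D" for d
          using norm_bidual_le[OF \<phi>(1) that] \<phi>(3) pos
          by (simp add: norm_divide field_simps)
        show "\<phi> d / ?r = ?r" using \<phi>(2) pos by (simp add: power2_eq_square)
      qed (rule d')
      then have "\<phi> d' = ?r * pairing c d'" using pos by (simp add: field_simps)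
      then show ?thesis by (simp only: pairing_scale_left[OF d' c(1)])
    qed
    moreover have "N (\<lambda>j. ?r * c j) = dn d"
      using c pos by (simp add: N_scale)
    moreover have "pairing (\<lambda>j. ?r * c j) d = complex_of_real ((dn d)\<^sup>2)"
      using c by (simp add: pairing_scale_left d power2_eq_square)
    ultimately show ?thesis
      by (intro bexI[OF _ scale_mem[OF c(1), of ?r]]) blast
  qed
  then obtain c where c: "c \<in> S" "N c = dn d" "pairing c d = complex_of_real ((dn d)\<^sup>2)"
    and unique: "\<And>\<phi> d'. \<phi> \<in> seq_bidual S N \<Longrightarrow> \<phi> d = complex_of_real ((dn d)\<^sup>2) \<Longrightarrow>
      seq_bidual_norm S N \<phi> = dn d \<Longrightarrow> d' \<in> D \<Longrightarrow> \<phi> d' = pairing c d'"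
    by blast
  have ev: "restrict (pairing c) D \<in> seq_bidual S N" by (rule evaluation_in_bidual[OF c(1)])
  have ev_norm: "seq_bidual_norm S N (restrict (pairing c) D) = dn d"
  proof (rule antisym)
    show "seq_bidual_norm S N (restrict (pairing c) D) \<le> dn d"
      using evaluation_norm_le[OF c(1)] c(2) by simp
    have "(dn d)\<^sup>2 \<le> seq_bidual_norm S N (restrict (pairing c) D) * dn d"
      using norm_bidual_le[OF ev d] d c(3) by (simp add: norm_power)
    then show "dn d \<le> seq_bidual_norm S N (restrict (pairing c) D)"
      using bidual_norm_ge0[OF ev] dual_norm_ge0[OF d]
      by (cases "dn d = 0") (auto simp: power2_eq_square)
  qed
  have "bidual_duality_map S N d = restrict (pairing c) D"
    unfolding bidual_duality_map_def
  proof (rule the_equality)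
    show "restrict (pairing c) D \<in> seq_bidual S N \<and>
        restrict (pairing c) D d = complex_of_real ((dn d)\<^sup>2) \<and>
        (dn d)\<^sup>2 = (seq_bidual_norm S N (restrict (pairing c) D))\<^sup>2"
      using ev ev_norm c d by simp
  next
    fix \<phi> assume \<phi>: "\<phi> \<in> seq_bidual S N \<and> \<phi> d = complex_of_real ((dn d)\<^sup>2) \<and>
        (dn d)\<^sup>2 = (seq_bidual_norm S N \<phi>)\<^sup>2"
    then have "seq_bidual_norm S N \<phi> = dn d"
      using bidual_norm_ge0 dual_norm_ge0[OF d] by (metis power2_eq_iff_nonneg)
    moreover have "\<phi> \<in> extensional D" using \<phi> unfolding seq_bidual_def by blast
    ultimately show "\<phi> = restrict (pairing c) D"
      using \<phi> unique by (intro extensionalityI[of _ D]) auto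
  qed
  then have "duality_map S N d = c"
    unfolding duality_map_def using c(1) pairing_separates
    by (intro the_equality) auto
  with c show ?mem ?norm ?pair by auto
qed

lemma duality_map_norm_eq_1:
  assumes "d \<in> D" "0 < dn d"
  shows "duality_map_norm S N = 1"
proof -
  let ?a = "inverse (complex_of_real (dn d))" and ?r = "complex_of_real (dn d)"
  have a: "(\<lambda>j. ?a * d j) \<in> D" by (rule dual_scale_mem[OF assms(1)])
  have "dn d \<le> dn d * dn (\<lambda>j. ?a * d j)"
    using dual_norm_scale_le[OF a, of ?r] assms(2) by (simp flip: mult.assoc)
  moreover have "dn (\<lambda>j. ?a * d j) \<le> 1"
    using dual_norm_scale_le[OF assms(1), of ?a] assms(2) by (simp add: norm_inverse)
  ultimately have "dn (\<lambda>j. ?a * d j) = 1" using assms(2) by simp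
  then have "{N (duality_map S N d) |d. d \<in> D \<and> dn d = 1} = {1}"
    using a duality_map(2) by force
  then show ?thesis by (simp add: duality_map_norm_def)
qed

end

section \<open>Synthesis operators\<close>

lemma scaleC_zero_left [simp]: "0 *\<^sub>C x = 0"
  by (metis mult_zero_left norm_eq_zero norm_scaleC norm_zero)

lemma scaleC_one [simp]: "1 *\<^sub>C x = x"
  by (metis of_real_1 scaleC_of_real scaleR_one)

lemma scaleC_diff_left: "(a - b) *\<^sub>C x = a *\<^sub>C x - b *\<^sub>C x"
  using scaleC_add_left[of "a - b" b x] by (simp add: algebra_simps)

lemma scaleC_diff_right: "a *\<^sub>C (x - y) = a *\<^sub>C x - a *\<^sub>C y"
  using scaleC_add_right[of a "x - y" y] by (simp add: algebra_simps)

lemma synthesis_unit_seq: "synthesis h (unit_seq j) = h j"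
proof -
  have "(\<lambda>k. unit_seq j k *\<^sub>C h k) = (\<lambda>k. if k = j then h k else 0)"
    by (auto simp: unit_seq_def)
  then show ?thesis
    using sums_single[of j h] by (simp add: synthesis_def sums_iff)
qed

lemma functional_synthesis:
  assumes "bounded_clinear F" "summable (\<lambda>j. c j *\<^sub>C h j)"
  shows "summable (\<lambda>j. c j * F (h j))" and "F (synthesis h c) = pairing c (\<lambda>j. F (h j))"
proof -
  have F: "bounded_linear F" "\<And>a x. F (a *\<^sub>C x) = a * F x"
    using assms(1) by (auto simp: bounded_clinear_def scaleC_complex_def)
  show "summable (\<lambda>j. c j * F (h j))"
    using bounded_linear.summable[OF F(1) assms(2)] by (simp add: F(2))
  show "F (synthesis h c) = pairing c (\<lambda>j. F (h j))"
    unfolding synthesis_def pairing_def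
    using bounded_linear.suminf[OF F(1) assms(2)] by (simp add: F(2))
qed

definition truncation :: "cseq \<Rightarrow> nat \<Rightarrow> cseq" where
  "truncation c n = (\<lambda>k. if k < n then c k else 0)"

lemma finite_support_truncation: "finite {j. truncation c n j \<noteq> 0}"
  by (rule finite_subset[of _ "{..<n}"]) (auto simp: truncation_def)

lemma sum_support_truncation:
  "(\<Sum>j | truncation c n j \<noteq> 0. truncation c n j *\<^sub>C h j) = (\<Sum>j<n. c j *\<^sub>C h j)"
  by (rule sum.mono_neutral_cong_left) (auto simp: truncation_def)

locale CB = BK +
  assumes CB_space: "CB_space S N"
begin

lemma unit_seq_mem: "unit_seq j \<in> S"
  using CB_space unfolding CB_space_def by blast

lemma truncation_mem: "truncation c n \<in> S"
proof (induction n)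
  case 0
  then show ?case using zero_mem by (simp add: truncation_def)
next
  case (Suc n)
  have "truncation c (Suc n) = (\<lambda>k. truncation c n k + c n * unit_seq n k)"
    by (auto simp: truncation_def unit_seq_def less_Suc_eq)
  then show ?case using add_mem[OF Suc scale_mem[OF unit_seq_mem]] by simp
qed

text \<open>Continuity of the coordinate functionals identifies the coefficients of the Schauder
  expansion of \<open>c\<close> as the entries of \<open>c\<close>.\<close>

lemma truncation_tendsto:
  assumes c: "c \<in> S"
  shows "(\<lambda>n. N (\<lambda>k. truncation c n k - c k)) \<longlonglongrightarrow> 0"
proof -
  obtain a :: cseq where
    a: "(\<lambda>n. N (\<lambda>k. c k - (\<Sum>j<n. a j * unit_seq j k))) \<longlonglongrightarrow> 0"
    using CB_space c unfolding CB_space_def by blast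
  have partial: "(\<lambda>k. \<Sum>j<n. a j * unit_seq j k) = truncation a n" for n
  proof
    fix k
    have "(\<Sum>j<n. a j * unit_seq j k) = (\<Sum>j<n. if k = j then a j else 0)"
      by (intro sum.cong) (auto simp: unit_seq_def)
    then show "(\<Sum>j<n. a j * unit_seq j k) = truncation a n k"
      by (simp add: truncation_def)
  qed
  have lim: "(\<lambda>n. N (\<lambda>k. truncation a n k - c k)) \<longlonglongrightarrow> 0"
    using a N_diff_commute[OF c truncation_mem] by (simp add: partial fun_cong[OF partial])
  have "c k = a k" for k
  proof -
    have "(\<lambda>n. truncation a n k) \<longlonglongrightarrow> c k"
      using pairing_tendsto[OF truncation_mem c lim unit_seq_dual[of k]]
      by (simp add: pairing_unit_seq)
    moreover have "(\<lambda>n. truncation a n k) \<longlonglongrightarrow> a k"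
      by (intro tendsto_eventually eventually_sequentiallyI[of "Suc k"])
        (simp add: truncation_def)
    ultimately show ?thesis by (rule LIMSEQ_unique)
  qed
  then have "c = a" by auto
  with lim show ?thesis by simp
qed

lemma norm_truncation_tendsto: "c \<in> S \<Longrightarrow> (\<lambda>n. N (truncation c n)) \<longlonglongrightarrow> N c"
  by (rule N_tendsto[OF truncation_mem _ truncation_tendsto])

text \<open>A synthesis operator that is bounded on finite sequences is defined on the whole space,
  because it maps the truncations of a sequence, which converge, to a Cauchy sequence.\<close>

lemma synthesis_summable:
  fixes h :: "nat \<Rightarrow> 'a::complex_banach"
  assumes bound: "\<And>c n. c \<in> S \<Longrightarrow> norm (\<Sum>j<n. c j *\<^sub>C h j) \<le> C * N (truncation c n)"
    and "0 \<le> C" and c: "c \<in> S"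
  shows "summable (\<lambda>j. c j *\<^sub>C h j)"
proof -
  have diff: "norm ((\<Sum>j<m. c j *\<^sub>C h j) - (\<Sum>j<n. c j *\<^sub>C h j))
      \<le> C * N (\<lambda>k. truncation c m k - truncation c n k)" for m n
  proof -
    let ?x = "\<lambda>k. truncation c m k - truncation c n k" and ?M = "max m n"
    have part: "(\<Sum>j<?M. truncation c l j *\<^sub>C h j) = (\<Sum>j<l. c j *\<^sub>C h j)" if "l \<le> ?M" for l
      using that by (intro sum.mono_neutral_cong_right) (auto simp: truncation_def)
    have "(\<Sum>j<?M. ?x j *\<^sub>C h j) = (\<Sum>j<m. c j *\<^sub>C h j) - (\<Sum>j<n. c j *\<^sub>C h j)"
      using part[of m] part[of n] by (simp add: scaleC_diff_left sum_subtractf)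
    moreover have "truncation ?x ?M = ?x"
      by (auto simp: truncation_def)
    ultimately show ?thesis
      using bound[OF diff_mem[OF truncation_mem[of c m] truncation_mem[of c n]], of ?M] by simp
  qed
  have "Cauchy (\<lambda>n. \<Sum>j<n. c j *\<^sub>C h j)"
    unfolding Cauchy_def
  proof (intro allI impI)
    fix e :: real assume "e > 0"
    define e' where "e' = e / (2 * (C + 1))"
    have "e' > 0" using \<open>e > 0\<close> \<open>0 \<le> C\<close> by (simp add: e'_def)
    then obtain n0 where n0: "\<And>n. n \<ge> n0 \<Longrightarrow> N (\<lambda>k. truncation c n k - c k) < e'"
      using order_tendstoD(2)[OF truncation_tendsto[OF c] \<open>e' > 0\<close>]
      unfolding eventually_sequentially by blast
    have "dist (\<Sum>j<m. c j *\<^sub>C h j) (\<Sum>j<n. c j *\<^sub>C h j) < e" if "m \<ge> n0" "n \<ge> n0" for m n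
    proof -
      have "N (\<lambda>k. truncation c m k - truncation c n k) \<le> e' + e'"
        using N_diff_triangle[OF truncation_mem c truncation_mem, of c m c n]
          N_diff_commute[OF c truncation_mem, of c n] n0[OF that(1)] n0[OF that(2)] by linarith
      then have "C * N (\<lambda>k. truncation c m k - truncation c n k) \<le> C * (e' + e')"
        using \<open>0 \<le> C\<close> by (rule mult_left_mono)
      also have "\<dots> < (C + 1) * (e' + e')" using \<open>e' > 0\<close> by simp
      also have "\<dots> = e" using \<open>0 \<le> C\<close> by (simp add: e'_def divide_simps)
      finally show ?thesis using diff[of m n] by (simp add: dist_norm)
    qed
    then show "\<exists>M. \<forall>m\<ge>M. \<forall>n\<ge>M. dist (\<Sum>j<m. c j *\<^sub>C h j) (\<Sum>j<n. c j *\<^sub>C h j) < e" by blast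
  qed
  then show ?thesis by (simp add: summable_iff_convergent Cauchy_convergent)
qed

lemma norm_synthesis_le:
  fixes h :: "nat \<Rightarrow> 'a::complex_banach"
  assumes bound: "\<And>c n. c \<in> S \<Longrightarrow> norm (\<Sum>j<n. c j *\<^sub>C h j) \<le> C * N (truncation c n)"
    and "0 \<le> C" and c: "c \<in> S"
  shows "norm (synthesis h c) \<le> C * N c"
proof (rule LIMSEQ_le)
  show "(\<lambda>n. norm (\<Sum>j<n. c j *\<^sub>C h j)) \<longlonglongrightarrow> norm (synthesis h c)"
    unfolding synthesis_def
    by (intro tendsto_norm summable_LIMSEQ synthesis_summable[OF assms])
  show "(\<lambda>n. C * N (truncation c n)) \<longlonglongrightarrow> C * N c"
    by (intro tendsto_mult_left norm_truncation_tendsto c)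
qed (use bound[OF c] in blast)

text \<open>The sequence \<open>\<lambda>j. F (h j)\<close> is the functional \<open>F \<circ> synthesis h\<close>, the image of \<open>F\<close> under the
  adjoint of synthesis, which is bounded because synthesis is.\<close>

lemma analysis_bounded:
  fixes h :: "nat \<Rightarrow> 'a::complex_banach"
  assumes bound: "\<And>c n. c \<in> S \<Longrightarrow> norm (\<Sum>j<n. c j *\<^sub>C h j) \<le> C * N (truncation c n)"
    and "0 \<le> C" and F: "bounded_clinear F"
  shows "(\<lambda>j. F (h j)) \<in> D" and "dn (\<lambda>j. F (h j)) \<le> C * onorm F"
proof -
  have lin: "bounded_linear F" using F by (simp add: bounded_clinear_def)
  have le: "cmod (pairing c (\<lambda>j. F (h j))) \<le> (C * onorm F) * N c" if c: "c \<in> S" for c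
  proof -
    have "cmod (pairing c (\<lambda>j. F (h j))) = cmod (F (synthesis h c))"
      using functional_synthesis(2)[OF F synthesis_summable[OF bound \<open>0 \<le> C\<close> c]] by simp
    also have "\<dots> \<le> onorm F * norm (synthesis h c)" by (rule onorm[OF lin])
    also have "\<dots> \<le> onorm F * (C * N c)"
      by (intro mult_left_mono norm_synthesis_le[OF bound \<open>0 \<le> C\<close> c] onorm_pos_le[OF lin])
    finally show ?thesis by (simp add: algebra_simps)
  qed
  then show "(\<lambda>j. F (h j)) \<in> D"
    using functional_synthesis(1)[OF F synthesis_summable[OF bound \<open>0 \<le> C\<close>]]
    unfolding seq_dual_def by blast
  show "dn (\<lambda>j. F (h j)) \<le> C * onorm F"
    using le \<open>0 \<le> C\<close> onorm_pos_le[OF lin] by (intro dual_norm_le) auto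
qed

text \<open>Testing a vector \<open>y\<close> in the range of synthesis with its own dual element \<open>\<lambda>x. sip x y\<close>
  gives its norm, so a bound on analysis is a bound on synthesis.\<close>

lemma synthesis_bounded_if_analysis_bounded:
  assumes sip: "compatible_sip sip"
    and an: "\<And>x. (\<lambda>j. sip (h j) x) \<in> D" "\<And>x. dn (\<lambda>j. sip (h j) x) \<le> B * norm x"
    and "0 \<le> B"
  shows "norm (\<Sum>j<n. c j *\<^sub>C h j) \<le> B * N (truncation c n)"
proof -
  let ?y = "\<Sum>j<n. c j *\<^sub>C h j"
  have add: "\<And>x y z. sip (x + y) z = sip x z + sip y z"
    and scale: "\<And>a x z. sip (a *\<^sub>C x) z = a * sip x z"
    and self: "\<And>x. sip x x = complex_of_real ((norm x)\<^sup>2)"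
    using sip unfolding compatible_sip_def by simp_all
  have "sip (\<Sum>j<m. c j *\<^sub>C h j) z = (\<Sum>j<m. c j * sip (h j) z)" for m z
  proof (induction m)
    case 0
    then show ?case using scale[of 0 0 z] by simp
  next
    case (Suc m)
    then show ?case by (simp add: add scale)
  qed
  then have "sip ?y ?y = (\<Sum>j<n. c j * sip (h j) ?y)" .
  also have "\<dots> = pairing (truncation c n) (\<lambda>j. sip (h j) ?y)"
    unfolding pairing_def
    by (subst suminf_finite[of "{..<n}"]) (auto simp: truncation_def)
  finally have "(norm ?y)\<^sup>2 = cmod (pairing (truncation c n) (\<lambda>j. sip (h j) ?y))"
    unfolding self by (metis norm_of_real abs_power2)
  also have "\<dots> \<le> dn (\<lambda>j. sip (h j) ?y) * N (truncation c n)"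
    by (rule norm_pairing_le[OF an(1) truncation_mem])
  also have "\<dots> \<le> (B * norm ?y) * N (truncation c n)"
    by (intro mult_right_mono an N_ge0 truncation_mem)
  finally have *: "norm ?y * norm ?y \<le> norm ?y * (B * N (truncation c n))"
    by (simp add: power2_eq_square algebra_simps)
  have "0 \<le> B * N (truncation c n)"
    using \<open>0 \<le> B\<close> N_ge0[OF truncation_mem] by simp
  then show ?thesis
    using * by (cases "norm ?y = 0") (auto simp: mult_le_cancel_left)
qed

end

section \<open>Perturbation of frames\<close>

theorem theorem5p4:
  fixes sip :: "'a::complex_banach \<Rightarrow> 'a \<Rightarrow> complex"
    and Xd :: "cseq set" and nXd :: "cseq \<Rightarrow> real"
    and K Kd P :: "'a \<Rightarrow> 'a"
    and f g :: "nat \<Rightarrow> 'a"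
    and A B \<alpha> \<beta> \<gamma> :: real
  assumes "strictly_convex TYPE('a)"
    and "separable_space (euclidean :: 'a topology)"
    and "compatible_sip sip"
    and "sip_duality sip"
    and "CB_space Xd nXd"
    and "uniformly_convex Xd nXd"
    and "bounded_clinear K"
    and "pseudo_inverse K Kd"
    and "\<forall>F \<in> dual_op K ` dual_space. onorm F \<le> onorm Kd * onorm (dual_op K F)"
    and "L_frame_bounds Xd nXd sip K f A B"
    and "\<alpha> \<ge> 0" and "\<beta> \<ge> 0" and "\<gamma> \<ge> 0"
    and "\<forall>c\<in>Xd. finite {j. c j \<noteq> 0} \<longrightarrow>
           norm (\<Sum>j | c j \<noteq> 0. c j *\<^sub>C (g j - f j))
             \<le> \<alpha> * norm (\<Sum>j | c j \<noteq> 0. c j *\<^sub>C f j)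
               + \<beta> * norm (\<Sum>j | c j \<noteq> 0. c j *\<^sub>C g j) + \<gamma> * nXd c"
    and "max \<beta> (\<alpha> + \<gamma> * inverse A * onorm Kd * duality_map_norm Xd nXd) < 1"
    and "orthogonal_projection_onto P (Q_map Xd nXd f g ` (dual_op K ` dual_space))"
  shows "L_frame Xd nXd sip (P \<circ> K) g"
proof -
  interpret uniformly_convex_BK Xd nXd
    using assms(5,6) by unfold_locales (auto simp: CB_space_def)
  interpret CB Xd nXd
    using assms(5) by unfold_locales
  have A: "A > 0" and B: "B > 0"
    and f_dual: "\<And>x. (\<lambda>j. sip (f j) x) \<in> D"
    and f_lower: "\<And>x. A * onorm (dual_op K (dual_elem sip x)) \<le> dn (\<lambda>j. sip (f j) x)"
    and f_upper: "\<And>x. dn (\<lambda>j. sip (f j) x) \<le> B * onorm (dual_elem sip x)"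
    using assms(10) unfolding L_frame_bounds_def by blast+
  have onorm_dual_elem: "onorm (dual_elem sip x) = norm x" for x
    using assms(4) unfolding sip_duality_def by blast
  have dual_elem: "bounded_clinear (dual_elem sip x)" for x
    using assms(4) unfolding sip_duality_def bij_betw_def dual_space_def by blast
  have dual_elem_surj: "\<exists>x. F = dual_elem sip x" if "bounded_clinear F" for F
    using assms(4) that unfolding sip_duality_def bij_betw_def dual_space_def by blast
  have Kd: "bounded_linear Kd" and K: "bounded_linear K" and P: "bounded_linear P"
    and PK: "bounded_clinear (P \<circ> K)"
    using assms(7,8,16)
    unfolding pseudo_inverse_def bounded_clinear_def orthogonal_projection_onto_def
    by (auto simp: o_def bounded_linear_compose)
  have onorm_P: "onorm P \<le> 1"
    and range_P: "range P = Q_map Xd nXd f g ` (dual_op K ` dual_space)"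
    using assms(16) unfolding orthogonal_projection_onto_def by blast+

  define \<kappa> where "\<kappa> = inverse A * onorm Kd"
  have \<kappa>: "\<kappa> \<ge> 0" using A onorm_pos_le[OF Kd] by (simp add: \<kappa>_def)
  \<comment> \<open>The norm of the duality map is \<open>1\<close> because the dual is nonzero, which \<open>unit_seq 0\<close> witnesses.\<close>
  have "cmod (pairing (unit_seq 0) (unit_seq 0)) = 1"
    by (simp add: pairing_unit_seq) (simp add: unit_seq_def)
  then have "dn (unit_seq 0) \<noteq> 0"
    using norm_pairing_le[OF unit_seq_dual unit_seq_mem, of 0 0] by auto
  then have "duality_map_norm Xd nXd = 1"
    using dual_norm_ge0[OF unit_seq_dual, of 0]
    by (intro duality_map_norm_eq_1[OF unit_seq_dual, of 0]) auto
  then have \<beta>: "\<beta> < 1" and small: "\<alpha> + \<gamma> * \<kappa> < 1"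
    using assms(15) by (auto simp: \<kappa>_def mult.assoc)

  have f_bound: "norm (\<Sum>j<n. c j *\<^sub>C f j) \<le> B * nXd (truncation c n)" for c n
    using f_upper B by (intro synthesis_bounded_if_analysis_bounded[OF assms(3) f_dual])
      (simp_all add: onorm_dual_elem)
  have perturb: "norm ((\<Sum>j<n. c j *\<^sub>C g j) - (\<Sum>j<n. c j *\<^sub>C f j))
      \<le> \<alpha> * norm (\<Sum>j<n. c j *\<^sub>C f j) + \<beta> * norm (\<Sum>j<n. c j *\<^sub>C g j)
        + \<gamma> * nXd (truncation c n)" for c n
    using assms(14)[rule_format, OF truncation_mem finite_support_truncation, of c n]
    unfolding sum_support_truncation by (simp add: scaleC_diff_right sum_subtractf)
  \<comment> \<open>Solving \<open>\<parallel>v\<parallel> \<le> \<parallel>u\<parallel> + \<alpha> \<parallel>u\<parallel> + \<beta> \<parallel>v\<parallel> + \<gamma> \<parallel>c\<parallel>\<close> for \<open>\<parallel>v\<parallel>\<close> with \<open>\<parallel>u\<parallel> \<le> B \<parallel>c\<parallel>\<close>\<close>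
  define C where "C = ((1 + \<alpha>) * B + \<gamma>) / (1 - \<beta>)"
  have C: "C \<ge> 0" using assms(11-13) \<beta> B by (simp add: C_def)
  have g_bound: "norm (\<Sum>j<n. c j *\<^sub>C g j) \<le> C * nXd (truncation c n)" for c n
  proof -
    let ?u = "\<Sum>j<n. c j *\<^sub>C f j" and ?v = "\<Sum>j<n. c j *\<^sub>C g j" and ?n = "nXd (truncation c n)"
    have "norm ?v \<le> norm ?u + norm (?v - ?u)"
      by (metis norm_triangle_sub)
    then have "(1 - \<beta>) * norm ?v \<le> (1 + \<alpha>) * norm ?u + \<gamma> * ?n"
      using perturb[where c=c and n=n] by (simp add: algebra_simps)
    also have "\<dots> \<le> (1 + \<alpha>) * (B * ?n) + \<gamma> * ?n"
      using assms(11) by (intro add_right_mono mult_left_mono f_bound) auto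
    finally show ?thesis
      using \<beta> by (simp add: C_def field_simps)
  qed
  note f_summable = synthesis_summable[OF f_bound less_imp_le[OF B]]
  note g_summable = synthesis_summable[OF g_bound C]
  have perturb_lim: "norm (synthesis g c - synthesis f c)
      \<le> \<alpha> * norm (synthesis f c) + \<beta> * norm (synthesis g c) + \<gamma> * nXd c" if c: "c \<in> Xd" for c
  proof (rule LIMSEQ_le)
    note lims = summable_LIMSEQ[OF f_summable[OF c], folded synthesis_def]
      summable_LIMSEQ[OF g_summable[OF c], folded synthesis_def]
    show "(\<lambda>n. norm ((\<Sum>j<n. c j *\<^sub>C g j) - (\<Sum>j<n. c j *\<^sub>C f j)))
        \<longlonglongrightarrow> norm (synthesis g c - synthesis f c)"
      by (intro tendsto_intros lims)
    show "(\<lambda>n. \<alpha> * norm (\<Sum>j<n. c j *\<^sub>C f j) + \<beta> * norm (\<Sum>j<n. c j *\<^sub>C g j)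
          + \<gamma> * nXd (truncation c n))
        \<longlonglongrightarrow> \<alpha> * norm (synthesis f c) + \<beta> * norm (synthesis g c) + \<gamma> * nXd c"
      by (intro tendsto_intros lims norm_truncation_tendsto c)
  qed (use perturb in blast)

  \<comment> \<open>Every vector in the range of \<open>P\<close> comes under synthesis by \<open>g\<close> from a sequence of comparable
    norm, because the duality map picks a sequence \<open>c\<close> with \<open>\<parallel>c\<parallel> \<le> \<kappa> \<parallel>U c\<parallel>\<close>.\<close>
  define C' where "C' = \<kappa> * (1 + \<beta>) / (1 - \<alpha> - \<gamma> * \<kappa>)"
  have C': "C' \<ge> 0" using \<kappa> assms(12) small by (simp add: C'_def)
  have preimage: "\<exists>c\<in>Xd. m = synthesis g c \<and> nXd c \<le> C' * norm m" if "m \<in> range P" for m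
  proof -
    obtain F0 where F0: "bounded_clinear F0" and m: "m = Q_map Xd nXd f g (dual_op K F0)"
      using \<open>m \<in> range P\<close> unfolding range_P dual_space_def by blast
    define F where "F = dual_op K F0"
    have F: "bounded_clinear F"
      using F0 assms(7) unfolding F_def dual_op_def bounded_clinear_def
      by (auto simp: o_def bounded_linear_compose)
    then obtain x where x: "F = dual_elem sip x" using dual_elem_surj by blast
    define d where "d = (\<lambda>j. F (f j))"
    have d: "d \<in> D" using f_dual[of x] by (simp add: d_def x dual_elem_def)
    define c where "c = duality_map Xd nXd d"
    have c: "c \<in> Xd" "nXd c = dn d" "pairing c d = complex_of_real ((dn d)\<^sup>2)"
      using duality_map[OF d] by (auto simp: c_def)
    have "seq_of_functional (dual_op (synthesis f) F) = d"
      by (simp add: seq_of_functional_def dual_op_def d_def synthesis_unit_seq)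
    then have m: "m = synthesis g c"
      using m by (simp add: Q_map_def c_def F_def)
    have "A * onorm (dual_op K F) \<le> nXd c"
      using f_lower[of x] c(2) by (simp add: d_def x dual_elem_def)
    then have "onorm (dual_op K F) \<le> inverse A * nXd c"
      using A by (simp add: field_simps)
    then have "onorm Kd * onorm (dual_op K F) \<le> onorm Kd * (inverse A * nXd c)"
      using onorm_pos_le[OF Kd] by (rule mult_left_mono)
    moreover have "onorm F \<le> onorm Kd * onorm (dual_op K F)"
      using assms(9) F0 unfolding F_def dual_space_def by blast
    ultimately have onorm_F: "onorm F \<le> \<kappa> * nXd c" by (simp add: \<kappa>_def algebra_simps)
    have "(nXd c)\<^sup>2 = cmod (F (synthesis f c))"
      using functional_synthesis(2)[OF F f_summable[OF c(1)]] c(2,3)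
      by (simp add: d_def norm_power)
    also have "\<dots> \<le> onorm F * norm (synthesis f c)"
      using F by (intro onorm) (simp add: bounded_clinear_def)
    also have "\<dots> \<le> \<kappa> * nXd c * norm (synthesis f c)"
      by (intro mult_right_mono onorm_F norm_ge_zero)
    finally have sq: "nXd c * nXd c \<le> nXd c * (\<kappa> * norm (synthesis f c))"
      by (simp add: power2_eq_square algebra_simps)
    have c_le: "nXd c \<le> \<kappa> * norm (synthesis f c)"
      using sq N_ge0[OF c(1)] \<kappa> by (cases "nXd c = 0") (auto simp: mult_le_cancel_left)
    have "norm (synthesis f c) \<le> norm m + norm (m - synthesis f c)"
      by (metis norm_triangle_sub norm_minus_commute)
    then have "(1 - \<alpha>) * norm (synthesis f c) \<le> (1 + \<beta>) * norm m + \<gamma> * nXd c"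
      using perturb_lim[OF c(1)] unfolding m by (simp add: algebra_simps)
    also have "\<dots> \<le> (1 + \<beta>) * norm m + \<gamma> * (\<kappa> * norm (synthesis f c))"
      using assms(13) c_le by (intro add_left_mono mult_left_mono)
    finally have "(1 - \<alpha> - \<gamma> * \<kappa>) * norm (synthesis f c) \<le> (1 + \<beta>) * norm m"
      by (simp add: algebra_simps)
    then have "norm (synthesis f c) \<le> (1 + \<beta>) * norm m / (1 - \<alpha> - \<gamma> * \<kappa>)"
      using small by (simp add: field_simps)
    then have "\<kappa> * norm (synthesis f c) \<le> \<kappa> * ((1 + \<beta>) * norm m / (1 - \<alpha> - \<gamma> * \<kappa>))"
      using \<kappa> by (rule mult_left_mono)
    then have "nXd c \<le> C' * norm m" using c_le by (simp add: C'_def)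
    then show ?thesis using c(1) m by blast
  qed

  \<comment> \<open>The summand \<open>1\<close> keeps the bounds positive when \<open>K\<close>, \<open>C'\<close> or \<open>C\<close> is zero.\<close>
  define A' where "A' = inverse (C' * onorm K + 1)"
  have CK: "C' * onorm K \<ge> 0" using C' onorm_pos_le[OF K] by simp
  have lower: "A' * onorm (dual_op (P \<circ> K) (dual_elem sip x)) \<le> dn (\<lambda>j. sip (g j) x)" for x
  proof -
    define d where "d = (\<lambda>j. sip (g j) x)"
    have d: "d \<in> D"
      using analysis_bounded(1)[OF g_bound C dual_elem[of x]] by (simp add: d_def dual_elem_def)
    have "cmod (dual_op (P \<circ> K) (dual_elem sip x) y) \<le> (dn d * (C' * onorm K)) * norm y" for y
    proof -
      obtain c where c: "c \<in> Xd" "P (K y) = synthesis g c" "nXd c \<le> C' * norm (P (K y))"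
        using preimage[of "P (K y)"] by blast
      have "cmod (dual_op (P \<circ> K) (dual_elem sip x) y) = cmod (pairing c d)"
        using functional_synthesis(2)[OF dual_elem[of x] g_summable[OF c(1)]] c(2)
        by (simp add: dual_op_def d_def dual_elem_def)
      also have "\<dots> \<le> dn d * nXd c" by (rule norm_pairing_le[OF d c(1)])
      also have "\<dots> \<le> dn d * (C' * norm (P (K y)))"
        by (intro mult_left_mono c dual_norm_ge0 d)
      also have "norm (P (K y)) \<le> onorm K * norm y"
      proof -
        have "norm (P (K y)) \<le> onorm P * norm (K y)" by (rule onorm[OF P])
        also have "\<dots> \<le> 1 * norm (K y)" by (intro mult_right_mono onorm_P norm_ge_zero)
        also have "\<dots> \<le> onorm K * norm y" using onorm[OF K] by simp
        finally show ?thesis .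
      qed
      finally show ?thesis
        using dual_norm_ge0[OF d] C' by (simp add: mult_left_mono mult.assoc)
    qed
    then have "onorm (dual_op (P \<circ> K) (dual_elem sip x)) \<le> dn d * (C' * onorm K)"
      using CK dual_norm_ge0[OF d] by (intro onorm_bound) auto
    also have "\<dots> \<le> dn d * (C' * onorm K + 1)"
      using dual_norm_ge0[OF d] by (intro mult_left_mono) auto
    finally show ?thesis using CK by (simp add: A'_def d_def field_simps)
  qed

  have "L_frame_bounds Xd nXd sip (P \<circ> K) g A' (C + 1)"
    unfolding L_frame_bounds_def
  proof (intro conjI allI PK lower)
    fix x
    show "(\<lambda>j. sip (g j) x) \<in> D"
      using analysis_bounded(1)[OF g_bound C dual_elem[of x]] by (simp add: dual_elem_def)
    have "dn (\<lambda>j. sip (g j) x) \<le> C * onorm (dual_elem sip x)"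
      using analysis_bounded(2)[OF g_bound C dual_elem[of x]] by (simp add: dual_elem_def)
    then show "dn (\<lambda>j. sip (g j) x) \<le> (C + 1) * onorm (dual_elem sip x)"
      by (simp add: onorm_dual_elem algebra_simps) (smt (verit) norm_ge_zero)
  qed (use CK C in \<open>simp_all add: A'_def\<close>)
  then show ?thesis unfolding L_frame_def by blast
qed

end
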